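(* Let $a,b$ be integers and $f(x)=(x-a)(x-b)$. If $n$ is a Frobenius pseudoprime with respect to $f(x)$, then $n$ is a pseudoprime to the base $a$ and a pseudoprime to the base $b$.
   Context: A pseudoprime to the base $a$ is a composite $n$ with $a^{n-1}\equiv 1\pmod n$. For monic polynomials $g_1,g_2$ over a commutative ring $R$ with identity, a monic $h\in R[x]$ is $\operatorname{gcmd}(g_1,g_2)$ if the ideal generated by $g_1,g_2$ equals the ideal generated by $h$ (it may fail to exist). Let $f(x)\in\mathbb{Z}[x]$ be monic of degree $d$ with discriminant $\Delta$. An odd integer $n>1$ is a Frobenius probable prime with respect to $f$ if $\gcd(n,f(0)\Delta)=1$ and, with all computations in $(\mathbb{Z}/n\mathbb{Z})[x]$: (Factorization) setting $f_0=f\bmod n$ and, for $1\le i\le d$, $F_i=\operatorname{gcmd}(x^{n^i}-x,f_{i-1})$ and $f_i=f_{i-1}/F_i$, all these gcmds exist and $f_d=1$; (Frobenius) for $2\le i\le d$, $F_i(x^n)\equiv 0\pmod{F_i(x)}$; (Jacobi) with $S=\sum_{2\mid i}\deg(F_i)/i$, one has $(-1)^S=\left(\frac{\Delta}{n}\right)$ (Jacobi symbol). A Frobenius pseudoprime with respect to $f$ is a composite Frobenius probable prime with respect to $f$. *)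

theory Defs
  imports
    "Subresultants.Resultant_Prelim"
    "HOL-Number_Theory.Number_Theory"
    "HOL-Algebra.UnivPoly"
begin

definition composite :: "nat \<Rightarrow> bool" where
  "composite n \<longleftrightarrow> n > 1 \<and> \<not> prime n"

definition pseudoprime :: "int \<Rightarrow> nat \<Rightarrow> bool" where
  "pseudoprime a n \<longleftrightarrow> composite n \<and> [a ^ (n - 1) = 1] (mod int n)"

definition jacobi :: "int \<Rightarrow> nat \<Rightarrow> int" where
  "jacobi a n = (\<Prod>p\<in>#prime_factorization n. Legendre a (int p))"

text \<open>The classical normalisation for a monic polynomial of degree \<open>d\<close>:
  \<open>(-1)^(d(d-1)/2) Res(f, f')\<close>, which equals the product of the squared differences of the roots.\<close>

definition discriminant :: "int poly \<Rightarrow> int" where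
  "discriminant f = (- 1) ^ (degree f * (degree f - 1) div 2) * resultant f (pderiv f)"

definition monic_UP :: "('r, 'm) ring_scheme \<Rightarrow> (nat \<Rightarrow> 'r) \<Rightarrow> bool" where
  "monic_UP R p \<longleftrightarrow> p \<in> carrier (UP R) \<and> up_ring.coeff (UP R) p (deg R p) = \<one>\<^bsub>R\<^esub>"

text \<open>A greatest common monic divisor need not exist, so it is a relation.
  It is unique when it exists.\<close>

definition is_gcmd ::
  "('r, 'm) ring_scheme \<Rightarrow> (nat \<Rightarrow> 'r) \<Rightarrow> (nat \<Rightarrow> 'r) \<Rightarrow> (nat \<Rightarrow> 'r) \<Rightarrow> bool" where
  "is_gcmd R g1 g2 h \<longleftrightarrow>
     monic_UP R h \<and> Idl\<^bsub>UP R\<^esub> {g1, g2} = Idl\<^bsub>UP R\<^esub> {h}"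

abbreviation Zmod :: "nat \<Rightarrow> int ring" where
  "Zmod n \<equiv> residue_ring (int n)"

abbreviation Zmod_poly :: "nat \<Rightarrow> (int, nat \<Rightarrow> int) up_ring" where
  "Zmod_poly n \<equiv> UP (Zmod n)"

abbreviation X_pow :: "nat \<Rightarrow> nat \<Rightarrow> nat \<Rightarrow> int" where
  "X_pow n k \<equiv> up_ring.monom (Zmod_poly n) \<one>\<^bsub>Zmod n\<^esub> k"

text \<open>Elements of \<open>UP R\<close> are coefficient sequences, so reduction acts on coefficients.\<close>

definition reduce_poly :: "nat \<Rightarrow> int poly \<Rightarrow> nat \<Rightarrow> int" where
  "reduce_poly n f = (\<lambda>k. Polynomial.coeff f k mod int n)"

definition subst_poly :: "nat \<Rightarrow> (nat \<Rightarrow> int) \<Rightarrow> (nat \<Rightarrow> int) \<Rightarrow> nat \<Rightarrow> int" where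
  "subst_poly n g p =
     eval (Zmod n) (Zmod_poly n) (\<lambda>c. up_ring.monom (Zmod_poly n) c 0) g p"

text \<open>\<open>F i\<close> and \<open>fs i\<close> are \<open>F\<^sub>i\<close> and \<open>f\<^sub>i\<close>. Since \<open>F i\<close> is monic, the equation
  \<open>fs (i - 1) = F i \<otimes> fs i\<close> determines the quotient \<open>fs i\<close>.\<close>

definition factorization_step ::
  "int poly \<Rightarrow> nat \<Rightarrow> (nat \<Rightarrow> nat \<Rightarrow> int) \<Rightarrow> (nat \<Rightarrow> nat \<Rightarrow> int) \<Rightarrow> bool" where
  "factorization_step f n F fs \<longleftrightarrow>
     fs 0 = reduce_poly n f \<and>
     (\<forall>i\<in>{1..degree f}.
        is_gcmd (Zmod n) (X_pow n (n ^ i) \<ominus>\<^bsub>Zmod_poly n\<^esub> X_pow n 1) (fs (i - 1)) (F i) \<and>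
        fs i \<in> carrier (Zmod_poly n) \<and>
        fs (i - 1) = F i \<otimes>\<^bsub>Zmod_poly n\<^esub> fs i) \<and>
     fs (degree f) = \<one>\<^bsub>Zmod_poly n\<^esub>"

definition frobenius_step :: "int poly \<Rightarrow> nat \<Rightarrow> (nat \<Rightarrow> nat \<Rightarrow> int) \<Rightarrow> bool" where
  "frobenius_step f n F \<longleftrightarrow>
     (\<forall>i\<in>{2..degree f}. \<exists>q\<in>carrier (Zmod_poly n).
        subst_poly n (X_pow n n) (F i) = F i \<otimes>\<^bsub>Zmod_poly n\<^esub> q)"

text \<open>The division in the exponent is exact whenever the other conditions of
  \<open>frobenius_probable_prime\<close> hold: modulo a prime divisor of \<open>n\<close>, the roots of \<open>F i\<close> are simple
  and the map \<open>r \<mapsto> r ^ n\<close> permutes them in orbits of size \<open>i\<close>.\<close>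

definition jacobi_step :: "int poly \<Rightarrow> nat \<Rightarrow> (nat \<Rightarrow> nat \<Rightarrow> int) \<Rightarrow> bool" where
  "jacobi_step f n F \<longleftrightarrow>
     (- 1) ^ (\<Sum>i | i \<in> {1..degree f} \<and> even i. deg (Zmod n) (F i) div i)
       = jacobi (discriminant f) n"

text \<open>The sequences \<open>F\<close> and \<open>fs\<close> are unique on the relevant indices.\<close>

definition frobenius_probable_prime :: "int poly \<Rightarrow> nat \<Rightarrow> bool" where
  "frobenius_probable_prime f n \<longleftrightarrow>
     lead_coeff f = 1 \<and> odd n \<and> n > 1 \<and> coprime (int n) (poly f 0 * discriminant f) \<and>
     (\<exists>F fs. factorization_step f n F fs \<and> frobenius_step f n F \<and> jacobi_step f n F)"

definition frobenius_pseudoprime :: "int poly \<Rightarrow> nat \<Rightarrow> bool" where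
  "frobenius_pseudoprime f n \<longleftrightarrow> composite n \<and> frobenius_probable_prime f n"

end

theory Submission
  imports Defs
begin

text \<open>The discriminant \<open>(a - b)^2\<close> is a square prime to \<open>n\<close>, so its Jacobi symbol is \<open>1\<close> and
  \<open>F2\<close> cannot have degree \<open>2\<close>. Degree \<open>1\<close> leaves the Jacobi step silent (then \<open>S = 0\<close>), but the
  Frobenius step makes the root of \<open>F2\<close> a root of \<open>F1\<close>; hence \<open>f\<close> is a square modulo \<open>n\<close> and its
  discriminant vanishes there, a contradiction. So \<open>F2 = 1\<close> and \<open>f = F1\<close> divides \<open>x^n - x\<close>;
  evaluate at \<open>a\<close> and at \<open>b\<close>, which are units modulo \<open>n\<close>.\<close>

section \<open>Degrees and leading coefficients of monic polynomials\<close>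

context UP_ring
begin

lemma monic_UP_iff: "monic_UP R p \<longleftrightarrow> p \<in> carrier P \<and> up_ring.coeff P p (deg R p) = \<one>"
  by (simp add: monic_UP_def P_def)

text \<open>In the convolution sum at this index only the term \<open>i = deg R p\<close> survives:
  a smaller \<open>i\<close> pushes the index of \<open>q\<close> beyond its degree, and a larger
  one exceeds the degree of \<open>p\<close>.\<close>

lemma coeff_mult_deg_add:
  assumes p: "p \<in> carrier P" and q: "q \<in> carrier P"
  shows "up_ring.coeff P (p \<otimes>\<^bsub>P\<^esub> q) (deg R p + deg R q) =
    up_ring.coeff P p (deg R p) \<otimes> up_ring.coeff P q (deg R q)"
proof -
  let ?N = "deg R p + deg R q"
  let ?s = "\<lambda>i. up_ring.coeff P p i \<otimes> up_ring.coeff P q (?N - i)"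
  have "?s i = (if deg R p = i then ?s i else \<zero>)" if "i \<le> ?N" for i
  proof (cases i "deg R p" rule: linorder_cases)
    case less
    then have "up_ring.coeff P q (?N - i) = \<zero>" by (intro deg_aboveD q) simp
    with less p show ?thesis by simp
  next
    case greater
    then have "up_ring.coeff P p i = \<zero>" by (intro deg_aboveD p)
    with greater q show ?thesis by simp
  qed simp
  then have "(\<Oplus>i\<in>{..?N}. ?s i) = (\<Oplus>i\<in>{..?N}. if deg R p = i then ?s i else \<zero>)"
    using p q by (intro R.finsum_cong') (auto simp: Pi_def)
  also have "\<dots> = ?s (deg R p)"
    using p q by (intro R.finsum_singleton) auto
  finally show ?thesis using p q by simp
qed

text \<open>For composite \<open>n\<close> the ring \<open>Zmod n\<close> may have zero divisors, so
  degrees need not add in general. For monic factors the top coefficient of the product is \<one>,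
  which is nonzero in a nontrivial ring.\<close>

lemma deg_mult_monic:
  assumes "\<one> \<noteq> \<zero>" and p: "monic_UP R p" and q: "monic_UP R q"
  shows "deg R (p \<otimes>\<^bsub>P\<^esub> q) = deg R p + deg R q"
proof (rule antisym)
  have pq: "p \<in> carrier P" "q \<in> carrier P" using p q by (auto simp: monic_UP_iff)
  then show "deg R (p \<otimes>\<^bsub>P\<^esub> q) \<le> deg R p + deg R q" by (rule deg_mult_ring)
  have "up_ring.coeff P (p \<otimes>\<^bsub>P\<^esub> q) (deg R p + deg R q) \<noteq> \<zero>"
    unfolding coeff_mult_deg_add[OF pq] using p q assms(1) by (simp add: monic_UP_iff)
  then show "deg R p + deg R q \<le> deg R (p \<otimes>\<^bsub>P\<^esub> q)"
    using pq by (intro deg_belowI) auto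
qed

lemma monic_UP_deg_0:
  assumes "monic_UP R p" "deg R p = 0"
  shows "p = \<one>\<^bsub>P\<^esub>"
proof -
  have "p \<in> carrier P" "up_ring.coeff P p 0 = \<one>" using assms by (auto simp: monic_UP_iff)
  with deg_zero_impl_monom[of p] assms show ?thesis by simp
qed

lemma monic_UP_deg_1E:
  assumes "monic_UP R p" "deg R p = 1"
  obtains c where "c \<in> carrier R" "p = up_ring.monom P \<one> 1 \<ominus>\<^bsub>P\<^esub> up_ring.monom P c 0"
proof
  let ?c = "\<ominus> up_ring.coeff P p 0"
  have p: "p \<in> carrier P" "up_ring.coeff P p 1 = \<one>" using assms by (auto simp: monic_UP_iff)
  then show c: "?c \<in> carrier R" by simp
  show "p = up_ring.monom P \<one> 1 \<ominus>\<^bsub>P\<^esub> up_ring.monom P ?c 0"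
  proof (rule up_eqI)
    fix n
    have "up_ring.coeff P p n = \<zero>" if "n > 1"
      using that p assms by (intro deg_aboveD) auto
    then show "up_ring.coeff P p n =
        up_ring.coeff P (up_ring.monom P \<one> 1 \<ominus>\<^bsub>P\<^esub> up_ring.monom P ?c 0) n"
      using p c by (cases "n = 0"; cases "n = 1") (auto simp: coeff_minus a_minus_def)
  qed (use p c in auto)
qed

end

section \<open>Evaluation homomorphisms and greatest common monic divisors\<close>

context UP_cring
begin

lemma eval_id_ring_hom_cring:
  assumes "x \<in> carrier R"
  shows "ring_hom_cring P R (eval R R id x)"
proof -
  interpret E: UP_pre_univ_prop R R id P by unfold_locales simp
  show ?thesis
    by unfold_locales (rule E.eval_ring_hom[OF assms])
qed

lemma eval_id_monom:
  assumes "x \<in> carrier R" "c \<in> carrier R"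
  shows "eval R R id x (up_ring.monom P c k) = c \<otimes> x [^] k"
proof -
  interpret E: UP_pre_univ_prop R R id P by unfold_locales simp
  show ?thesis using E.eval_monom assms by simp
qed

lemma eval_id_linear:
  assumes "x \<in> carrier R" "c \<in> carrier R"
  shows "eval R R id x (up_ring.monom P \<one> 1 \<ominus>\<^bsub>P\<^esub> up_ring.monom P c 0) = x \<ominus> c"
proof -
  interpret E: ring_hom_cring P R "eval R R id x" by (rule eval_id_ring_hom_cring) fact
  show ?thesis using assms by (simp add: a_minus_def eval_id_monom del: monom_one monom_a_inv)
qed

lemma eval_id_monom_diff:
  assumes "x \<in> carrier R"
  shows "eval R R id x (up_ring.monom P \<one> m \<ominus>\<^bsub>P\<^esub> up_ring.monom P \<one> k) = x [^] m \<ominus> x [^] k"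
proof -
  interpret E: ring_hom_cring P R "eval R R id x" by (rule eval_id_ring_hom_cring) fact
  show ?thesis using assms by (simp add: a_minus_def eval_id_monom del: monom_one monom_a_inv)
qed

text \<open>By commutativity the ideal generated by \<open>h\<close> consists of the multiples of
  \<open>h\<close>, and \<open>g1\<close> lies in it because the two ideals agree.\<close>

lemma is_gcmd_dvdE:
  assumes "is_gcmd R g1 g2 h" "g1 \<in> carrier P" "g2 \<in> carrier P"
  obtains u where "u \<in> carrier P" "g1 = u \<otimes>\<^bsub>P\<^esub> h"
proof -
  have h: "h \<in> carrier P" using assms by (simp add: is_gcmd_def monic_UP_iff)
  have "g1 \<in> Idl\<^bsub>P\<^esub> {g1, g2}"
    using P.genideal_self[of "{g1, g2}"] assms by simp
  also have "\<dots> = PIdl\<^bsub>P\<^esub> h"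
    using assms h by (simp add: is_gcmd_def P_def[symmetric] P.cgenideal_eq_genideal)
  finally show ?thesis using that by (auto simp: cgenideal_def)
qed

text \<open>The kernel of \<open>\<phi>\<close> is an ideal containing \<open>g1\<close> and
  \<open>g2\<close>, hence it contains the ideal they generate, and \<open>h\<close> lies there.
  With \<open>\<phi>\<close> an evaluation, a common root of \<open>g1\<close> and \<open>g2\<close>
  is a root of \<open>h\<close>.\<close>

lemma is_gcmd_hom_eq_zero:
  assumes "is_gcmd R g1 g2 h" "g1 \<in> carrier P" "g2 \<in> carrier P"
    and hom: "ring_hom_cring P S \<phi>" and "\<phi> g1 = \<zero>\<^bsub>S\<^esub>" "\<phi> g2 = \<zero>\<^bsub>S\<^esub>"
  shows "\<phi> h = \<zero>\<^bsub>S\<^esub>"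
proof -
  interpret H: ring_hom_cring P S \<phi> by (rule hom)
  have h: "h \<in> carrier P" using assms by (simp add: is_gcmd_def monic_UP_iff)
  have "Idl\<^bsub>P\<^esub> {g1, g2} \<subseteq> a_kernel P S \<phi>"
  proof (rule P.genideal_minimal)
    show "ideal (a_kernel P S \<phi>) P" by (rule H.ring.kernel_is_ideal)
    show "{g1, g2} \<subseteq> a_kernel P S \<phi>"
      unfolding a_kernel_def' using assms(2,3,5,6) by blast
  qed
  moreover have "h \<in> Idl\<^bsub>P\<^esub> {g1, g2}"
    using assms(1) P.genideal_self'[OF h] by (simp add: is_gcmd_def P_def[symmetric])
  ultimately show ?thesis unfolding a_kernel_def' by blast
qed

text \<open>The inner \<open>eval\<close>, with constants embedded as monomials of degree 0, is
  composition with \<open>g\<close>, the shape used by \<open>subst_poly\<close>. Composition and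
  evaluation are both ring homomorphisms, so it is enough to follow the variable and the constant
  separately.\<close>

lemma eval_subst_linear:
  assumes c: "c \<in> carrier R" and x: "x \<in> carrier R" and g: "g \<in> carrier P"
  shows "eval R R id x (eval R P (\<lambda>c. up_ring.monom P c 0) g
      (up_ring.monom P \<one> 1 \<ominus>\<^bsub>P\<^esub> up_ring.monom P c 0)) = eval R R id x g \<ominus> c"
proof -
  interpret S: UP_pre_univ_prop R P "\<lambda>c. up_ring.monom P c 0" P
    by unfold_locales (rule const_ring_hom)
  interpret SH: ring_hom_cring P P "eval R P (\<lambda>c. up_ring.monom P c 0) g"
    by unfold_locales (rule S.eval_ring_hom[OF g])
  interpret E: ring_hom_cring P R "eval R R id x" by (rule eval_id_ring_hom_cring) fact
  show ?thesis
    using c x g S.eval_const[OF g, of "\<ominus> c"] S.eval_const[OF g c] S.eval_monom1[OF g]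
    by (simp add: a_minus_def eval_id_monom del: monom_one monom_a_inv)
qed

text \<open>If \<open>F2 = x - d\<close>, the divisibility \<open>F2(x^k) \<equiv> 0 (mod F2)\<close> says \<open>d^k = d\<close>, so \<open>d\<close> is a common
  root of \<open>x^k - x\<close> and \<open>f\<close>, hence a root of their greatest common monic divisor \<open>F1 = x - c\<close>.\<close>

lemma double_root_of_linear_factors:
  assumes f: "f = F1 \<otimes>\<^bsub>P\<^esub> F2"
    and gcmd: "is_gcmd R (up_ring.monom P \<one> k \<ominus>\<^bsub>P\<^esub> up_ring.monom P \<one> 1) f F1"
    and F2: "monic_UP R F2" and deg: "deg R F1 = 1" "deg R F2 = 1"
    and frob: "q \<in> carrier P"
      "eval R P (\<lambda>c. up_ring.monom P c 0) (up_ring.monom P \<one> k) F2 = F2 \<otimes>\<^bsub>P\<^esub> q"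
  obtains c where "c \<in> carrier R"
    "\<And>x. x \<in> carrier R \<Longrightarrow> eval R R id x f = (x \<ominus> c) \<otimes> (x \<ominus> c)"
proof -
  have F1: "monic_UP R F1" using gcmd by (simp add: is_gcmd_def)
  have carr: "F1 \<in> carrier P" "F2 \<in> carrier P" "f \<in> carrier P"
    using F1 F2 f by (auto simp: monic_UP_iff)
  obtain c where c: "c \<in> carrier R" "F1 = up_ring.monom P \<one> 1 \<ominus>\<^bsub>P\<^esub> up_ring.monom P c 0"
    using monic_UP_deg_1E[OF F1 deg(1)] .
  obtain d where d: "d \<in> carrier R" "F2 = up_ring.monom P \<one> 1 \<ominus>\<^bsub>P\<^esub> up_ring.monom P d 0"
    using monic_UP_deg_1E[OF F2 deg(2)] .
  interpret E: ring_hom_cring P R "eval R R id d" by (rule eval_id_ring_hom_cring[OF d(1)])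
  have root: "eval R R id d F2 = \<zero>"
    using d by (simp only: eval_id_linear) (simp add: a_minus_def R.r_neg)
  have "d [^] k \<ominus> d = eval R R id d (eval R P (\<lambda>c. up_ring.monom P c 0) (up_ring.monom P \<one> k) F2)"
    using d eval_subst_linear[OF d(1) d(1), of "up_ring.monom P \<one> k"]
    by (simp add: eval_id_monom del: monom_one)
  also have "\<dots> = \<zero>"
    using carr frob root by simp
  finally have "eval R R id d (up_ring.monom P \<one> k \<ominus>\<^bsub>P\<^esub> up_ring.monom P \<one> 1) = \<zero>"
    using d by (simp only: eval_id_monom_diff R.nat_pow_eone)
  moreover have "eval R R id d f = \<zero>"
    using f carr root by simp
  ultimately have "eval R R id d F1 = \<zero>"
    using carr by (intro is_gcmd_hom_eq_zero[OF gcmd _ _ E.ring_hom_cring_axioms]) auto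
  then have "d \<ominus> c = \<zero>" using c d by (simp only: eval_id_linear)
  then have "d = c" using c d by simp
  show ?thesis
  proof (rule that[OF c(1)])
    fix x assume x: "x \<in> carrier R"
    interpret X: ring_hom_cring P R "eval R R id x" by (rule eval_id_ring_hom_cring[OF x])
    have "eval R R id x f = eval R R id x F1 \<otimes> eval R R id x F2"
      using f carr by simp
    then show "eval R R id x f = (x \<ominus> c) \<otimes> (x \<ominus> c)"
      using c d x \<open>d = c\<close> by (simp only: eval_id_linear)
  qed
qed

end

section \<open>Reduction of integer polynomials modulo \<open>n\<close>\<close>

context
  fixes n :: nat
  assumes n: "n > 1"
begin

interpretation res: residues "int n" "Zmod n"
  by unfold_locales (use n in simp_all)

interpretation UP_cring "Zmod n" "Zmod_poly n"
  by unfold_locales simp_all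

lemma reduce_poly_closed: "reduce_poly n f \<in> carrier (Zmod_poly n)"
proof -
  have "reduce_poly n f \<in> up (Zmod n)"
  proof (rule mem_upI)
    show "reduce_poly n f k \<in> carrier (Zmod n)" for k
      using n by (simp add: reduce_poly_def res.res_carrier_eq)
    have "bound \<zero>\<^bsub>Zmod n\<^esub> (degree f) (reduce_poly n f)"
      by (rule bound.intro) (simp add: reduce_poly_def coeff_eq_0 res.res_zero_eq)
    then show "\<exists>m. bound \<zero>\<^bsub>Zmod n\<^esub> m (reduce_poly n f)" ..
  qed
  then show ?thesis by (simp add: UP_def)
qed

lemma coeff_reduce_poly:
  "up_ring.coeff (Zmod_poly n) (reduce_poly n f) k = Polynomial.coeff f k mod int n"
  using reduce_poly_closed[of f] by (simp add: UP_def reduce_poly_def)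

text \<open>The leading coefficient 1 stays nonzero modulo \<open>n\<close> because
  \<open>n > 1\<close>, so the degree does not drop.\<close>

lemma deg_reduce_poly:
  assumes "lead_coeff f = 1"
  shows "deg (Zmod n) (reduce_poly n f) = degree f"
proof (rule antisym)
  show "deg (Zmod n) (reduce_poly n f) \<le> degree f"
    by (intro deg_aboveI reduce_poly_closed)
      (simp add: coeff_reduce_poly coeff_eq_0 res.res_zero_eq)
  show "degree f \<le> deg (Zmod n) (reduce_poly n f)"
    using assms n by (intro deg_belowI reduce_poly_closed)
      (simp add: coeff_reduce_poly res.res_zero_eq)
qed

text \<open>One step of Horner's scheme in \<open>Zmod_poly n\<close>, serving the induction in
  \<open>eval_reduce_poly\<close>.\<close>

lemma reduce_poly_pCons:
  "reduce_poly n (pCons c p) = up_ring.monom (Zmod_poly n) (c mod int n) 0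
     \<oplus>\<^bsub>Zmod_poly n\<^esub> X_pow n 1 \<otimes>\<^bsub>Zmod_poly n\<^esub> reduce_poly n p"
proof (rule up_eqI)
  have c: "c mod int n \<in> carrier (Zmod n)"
    using n by (simp add: res.res_carrier_eq)
  then show "up_ring.monom (Zmod_poly n) (c mod int n) 0
      \<oplus>\<^bsub>Zmod_poly n\<^esub> X_pow n 1 \<otimes>\<^bsub>Zmod_poly n\<^esub> reduce_poly n p \<in> carrier (Zmod_poly n)"
    by (intro P.a_closed P.m_closed monom_closed res.one_closed reduce_poly_closed)
  fix k
  show "up_ring.coeff (Zmod_poly n) (reduce_poly n (pCons c p)) k =
    up_ring.coeff (Zmod_poly n) (up_ring.monom (Zmod_poly n) (c mod int n) 0
     \<oplus>\<^bsub>Zmod_poly n\<^esub> X_pow n 1 \<otimes>\<^bsub>Zmod_poly n\<^esub> reduce_poly n p) k"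
  proof (cases k)
    case 0
    have "up_ring.coeff (Zmod_poly n) (X_pow n 1 \<otimes>\<^bsub>Zmod_poly n\<^esub> reduce_poly n p) 0 = \<zero>\<^bsub>Zmod n\<^esub>"
      using reduce_poly_closed[of p] by simp
    with 0 c reduce_poly_closed[of p] show ?thesis
      by (simp add: coeff_reduce_poly res.res_add_eq res.res_zero_eq del: coeff_mult)
  next
    case (Suc m)
    have "up_ring.coeff (Zmod_poly n) (X_pow n 1 \<otimes>\<^bsub>Zmod_poly n\<^esub> reduce_poly n p) (Suc m) =
        Polynomial.coeff p m mod int n"
      using reduce_poly_closed[of p] coeff_monom_mult[OF res.one_closed, of "reduce_poly n p" 1 m]
      by (simp add: coeff_reduce_poly res.res_mult_eq res.res_one_eq del: coeff_mult)
    with Suc c reduce_poly_closed[of p] show ?thesis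
      by (simp add: coeff_reduce_poly res.res_add_eq res.res_zero_eq del: coeff_mult)
  qed
qed (rule reduce_poly_closed)

text \<open>Evaluation is a ring homomorphism, so it turns each Horner step into the corresponding
  step for residues. This carries facts about \<open>Zmod_poly n\<close> back to integer
  congruences.\<close>

lemma eval_reduce_poly:
  "eval (Zmod n) (Zmod n) id (x mod int n) (reduce_poly n f) = poly f x mod int n"
proof (induction f)
  case 0
  have x: "x mod int n \<in> carrier (Zmod n)" using n by (simp add: res.res_carrier_eq)
  have zero: "reduce_poly n 0 = \<zero>\<^bsub>Zmod_poly n\<^esub>"
    by (rule up_eqI) (simp_all add: coeff_reduce_poly reduce_poly_closed res.res_zero_eq)
  interpret E: ring_hom_cring "Zmod_poly n" "Zmod n" "eval (Zmod n) (Zmod n) id (x mod int n)"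
    by (rule eval_id_ring_hom_cring[OF x])
  show ?case unfolding zero E.hom_zero by (simp add: res.res_zero_eq)
next
  case (pCons c p)
  have x: "x mod int n \<in> carrier (Zmod n)" and c: "c mod int n \<in> carrier (Zmod n)"
    using n by (simp_all add: res.res_carrier_eq)
  interpret E: ring_hom_cring "Zmod_poly n" "Zmod n" "eval (Zmod n) (Zmod n) id (x mod int n)"
    by (rule eval_id_ring_hom_cring[OF x])
  let ?ev = "eval (Zmod n) (Zmod n) id (x mod int n)"
  have "?ev (reduce_poly n (pCons c p)) = ?ev (up_ring.monom (Zmod_poly n) (c mod int n) 0)
      \<oplus>\<^bsub>Zmod n\<^esub> ?ev (X_pow n 1) \<otimes>\<^bsub>Zmod n\<^esub> ?ev (reduce_poly n p)"
    unfolding reduce_poly_pCons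
    by (simp only: E.hom_add E.hom_mult monom_closed P.m_closed c res.one_closed reduce_poly_closed)
  also have "\<dots> = (c mod int n) \<oplus>\<^bsub>Zmod n\<^esub> (x mod int n) \<otimes>\<^bsub>Zmod n\<^esub> (poly p x mod int n)"
    unfolding eval_id_monom[OF x c] eval_id_monom[OF x res.one_closed] pCons.IH
    using x c by (simp del: One_nat_def)
  also have "\<dots> = poly (pCons c p) x mod int n"
    by (simp add: res.res_add_eq res.res_mult_eq mod_simps)
  finally show ?case .
qed

end

section \<open>The discriminant of a quadratic and the Jacobi symbol of a square\<close>

lemma det_dim_2:
  assumes "A \<in> carrier_mat 2 2"
  shows "det A = A $$ (0, 0) * A $$ (1, 1) - A $$ (0, 1) * A $$ (1, 0)"
proof -
  have [simp]: "dim_row A = 2" "dim_col A = 2" using assms by auto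
  have "mat_delete A i 0 \<in> carrier_mat 1 1" for i
    by (simp add: mat_delete_def)
  then show ?thesis
    by (simp add: laplace_expansion_column[OF assms, of 0] cofactor_def det_single mat_delete_def
        numeral_2_eq_2 lessThan_Suc)
qed

lemma det_dim_3:
  assumes "A \<in> carrier_mat 3 3"
  shows "det A = A $$ (0, 0) * (A $$ (1, 1) * A $$ (2, 2) - A $$ (1, 2) * A $$ (2, 1))
    - A $$ (1, 0) * (A $$ (0, 1) * A $$ (2, 2) - A $$ (0, 2) * A $$ (2, 1))
    + A $$ (2, 0) * (A $$ (0, 1) * A $$ (1, 2) - A $$ (0, 2) * A $$ (1, 1))"
proof -
  have [simp]: "dim_row A = 3" "dim_col A = 3" using assms by auto
  have "mat_delete A i 0 \<in> carrier_mat 2 2" for i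
    by (simp add: mat_delete_def)
  then show ?thesis
    by (simp add: laplace_expansion_column[OF assms, of 0] cofactor_def det_dim_2 mat_delete_def
        eval_nat_numeral lessThan_Suc algebra_simps)
qed

text \<open>The Sylvester matrix of a quadratic and its derivative is 3 by 3, with determinant
  \<open>- (a - b)^2\<close>. The normalising sign has exponent \<open>2 * 1 div 2 = 1\<close> and
  cancels the minus.\<close>

lemma discriminant_quadratic:
  "discriminant ([:- a, 1:] * [:- b, 1:]) = (a - b)\<^sup>2"
proof -
  let ?f = "[:a * b, - (a + b), 1:]" and ?g = "[:- (a + b), 2:]"
  have "[:- a, 1:] * [:- b, 1:] = ?f" by simp
  moreover have "pderiv ?f = ?g" by (simp add: pderiv_pCons)
  moreover have "resultant ?f ?g = - (a - b)\<^sup>2"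
  proof -
    have "sylvester_mat ?f ?g \<in> carrier_mat 3 3"
      using sylvester_carrier_mat[of ?f ?g] by (simp add: eval_nat_numeral)
    then show ?thesis
      unfolding resultant_def
      by (simp add: det_dim_3 sylvester_index_mat power2_eq_square algebra_simps)
  qed
  ultimately show ?thesis
    unfolding discriminant_def by (simp only:) simp
qed

text \<open>No prime factor of \<open>n\<close> divides \<open>x\<close>, so \<open>x^2\<close> is a
  nonzero quadratic residue, witnessed by \<open>x\<close>, modulo each of them. Every Legendre
  factor is therefore 1.\<close>

lemma jacobi_square:
  assumes "coprime x (int n)" "n > 0"
  shows "jacobi (x\<^sup>2) n = 1"
proof -
  have "Legendre (x\<^sup>2) (int p) = 1" if "p \<in># prime_factorization n" for p
  proof -
    have p: "prime p" "p dvd n" using that by auto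
    have "\<not> int p dvd x"
    proof
      assume "int p dvd x"
      with p(2) assms(1) have "is_unit (int p)"
        by (meson coprime_common_divisor int_dvd_int_iff)
      with p(1) show False by (simp add: prime_gt_1_nat)
    qed
    then have "\<not> [x\<^sup>2 = 0] (mod int p)"
      using p(1) by (simp add: cong_0_iff prime_dvd_power_iff)
    moreover have "QuadRes (int p) (x\<^sup>2)" unfolding QuadRes_def by (rule exI[of _ x]) simp
    ultimately show ?thesis by (simp add: Legendre_def)
  qed
  then have "image_mset (\<lambda>p. Legendre (x\<^sup>2) (int p)) (prime_factorization n) =
      image_mset (\<lambda>_. 1) (prime_factorization n)"
    by (intro image_mset_cong)
  then show ?thesis by (simp add: jacobi_def)
qed

section \<open>Frobenius pseudoprimes for a quadratic with integer roots\<close>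

lemma pseudoprime_if_frobenius_pseudoprime_quadratic:
  assumes "frobenius_pseudoprime ([:- a, 1:] * [:- b, 1:]) n"
  shows "pseudoprime a n"
proof -
  let ?f = "[:- a, 1:] * [:- b, 1:]" and ?R = "Zmod n" and ?P = "Zmod_poly n"
  have deg_f: "degree ?f = 2" by simp
  have poly_f: "poly ?f x = (x - a) * (x - b)" for x
    by (simp only: poly_mult) simp
  have comp: "composite n" and n: "n > 1" and cop: "coprime (int n) (poly ?f 0 * discriminant ?f)"
    using assms unfolding frobenius_pseudoprime_def frobenius_probable_prime_def by auto
  obtain F fs where fact: "factorization_step ?f n F fs" and frob: "frobenius_step ?f n F"
    and jac: "jacobi_step ?f n F"
    using assms unfolding frobenius_pseudoprime_def frobenius_probable_prime_def by auto
  interpret res: residues "int n" ?R by unfold_locales (use n in simp_all)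
  interpret UP_cring ?R ?P by unfold_locales simp_all
  have one: "\<one>\<^bsub>?R\<^esub> \<noteq> \<zero>\<^bsub>?R\<^esub>" by (simp add: res.res_one_eq res.res_zero_eq)
  have carr: "x mod int n \<in> carrier ?R" for x using n by (simp add: res.res_carrier_eq)
  define f where "f = reduce_poly n ?f"
  have eval_f: "eval ?R ?R id (x mod int n) f = ((x - a) * (x - b)) mod int n" for x
    unfolding f_def eval_reduce_poly[OF n] poly_f ..
  have gcmd1: "is_gcmd ?R (X_pow n n \<ominus>\<^bsub>?P\<^esub> X_pow n 1) f (F 1)"
    and gcmd2: "is_gcmd ?R (X_pow n (n ^ 2) \<ominus>\<^bsub>?P\<^esub> X_pow n 1) (fs 1) (F 2)"
    and fs: "f = F 1 \<otimes>\<^bsub>?P\<^esub> fs 1" "fs 1 = F 2 \<otimes>\<^bsub>?P\<^esub> fs 2" "fs 2 = \<one>\<^bsub>?P\<^esub>"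
    using fact unfolding factorization_step_def deg_f f_def
    by (auto dest: bspec[of _ _ 1] bspec[of _ _ 2])
  have F: "monic_UP ?R (F 1)" "monic_UP ?R (F 2)"
    using gcmd1 gcmd2 by (auto simp: is_gcmd_def)
  have F_carr: "F 1 \<in> carrier ?P" "F 2 \<in> carrier ?P"
    using F by (auto simp: monic_UP_iff)
  have f_eq: "f = F 1 \<otimes>\<^bsub>?P\<^esub> F 2" using fs F_carr by simp
  have f_carr: "f \<in> carrier ?P" using f_eq F_carr by simp
  have "deg ?R f = 2" unfolding f_def using deg_reduce_poly[OF n, of ?f] deg_f by simp
  then have deg_sum: "deg ?R (F 1) + deg ?R (F 2) = 2"
    using deg_mult_monic[OF one F] f_eq by simp
  \<comment> \<open>Here \<open>f(0) = a * b\<close>, and the discriminant is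
    \<open>(a - b)^2\<close>. The first fact permits the final cancellation of \<open>a\<close>; the
    second excludes degrees 2 and 1 for \<open>F 2\<close>.\<close>
  have cop_ab: "coprime a (int n)" "coprime (a - b) (int n)"
    using cop unfolding discriminant_quadratic poly_f by (simp_all add: coprime_commute[of "int n"])
  have "deg ?R (F 2) \<noteq> 2"
  proof
    assume "deg ?R (F 2) = 2"
    \<comment> \<open>The exponent has the single term \<open>2 div 2 = 1\<close>, which forces the
      Jacobi symbol to be -1.\<close>
    moreover have "{i \<in> {1..2}. even i} = {2::nat}" by auto
    ultimately have "jacobi (discriminant ?f) n = - 1"
      using jac unfolding jacobi_step_def deg_f by simp
    then show False
      using jacobi_square[OF cop_ab(2)] n unfolding discriminant_quadratic by simp
  qed
  moreover have "deg ?R (F 2) \<noteq> 1"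
  proof
    assume deg_F2: "deg ?R (F 2) = 1"
    with deg_sum have deg_F1: "deg ?R (F 1) = 1" by simp
    obtain q where q: "q \<in> carrier ?P" "subst_poly n (X_pow n n) (F 2) = F 2 \<otimes>\<^bsub>?P\<^esub> q"
      using frob unfolding frobenius_step_def deg_f by auto
    obtain c where c: "c \<in> carrier ?R"
      "\<And>x. x \<in> carrier ?R \<Longrightarrow> eval ?R ?R id x f = (x \<ominus>\<^bsub>?R\<^esub> c) \<otimes>\<^bsub>?R\<^esub> (x \<ominus>\<^bsub>?R\<^esub> c)"
      using double_root_of_linear_factors[OF f_eq gcmd1 F(2) deg_F1 deg_F2 q(1)] q(2)
      unfolding subst_poly_def by blast
    \<comment> \<open>Elements of \<open>Zmod n\<close> are integers, so \<open>c\<close> can be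
      used directly in integer congruences.\<close>
    have sq: "((x - a) * (x - b)) mod int n = ((x - c) * (x - c)) mod int n" for x
      using c(2)[OF carr, of x] unfolding eval_f
      by (simp add: a_minus_def res.res_neg_eq res.res_add_eq res.res_mult_eq mod_simps)
    \<comment> \<open>Setting \<open>x\<close> to \<open>a\<close> or \<open>b\<close> kills the
      left side of \<open>sq\<close>; setting it to \<open>c\<close> kills the right side.\<close>
    have dvds: "int n dvd (a - c) * (a - c)" "int n dvd (b - c) * (b - c)" "int n dvd (c - a) * (c - b)"
      unfolding mod_eq_0_iff_dvd[symmetric]
      using sq[of a, symmetric] sq[of b, symmetric] sq[of c]
      by (simp_all only: diff_self mult_zero_left mult_zero_right mod_0)
    \<comment> \<open>This combination is the expansion of \<open>((a - c) - (b - c))^2\<close>. It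
      shows concretely that the discriminant of a square vanishes modulo \<open>n\<close>.\<close>
    have "int n dvd (a - c) * (a - c) + (b - c) * (b - c) - 2 * ((c - a) * (c - b))"
      by (rule dvd_diff[OF dvd_add[OF dvds(1,2)] dvd_mult[OF dvds(3)]])
    also have "\<dots> = (a - b)\<^sup>2" by (simp add: power2_eq_square algebra_simps)
    finally have "is_unit (int n)"
      using cop_ab(2) by (meson coprime_common_divisor coprime_power_left_iff dvd_refl pos2)
    with n show False by simp
  qed
  ultimately have "deg ?R (F 2) = 0" using deg_sum by linarith
  then have "F 1 = f"
    using monic_UP_deg_0[OF F(2)] f_eq F_carr by simp
  then obtain u where u: "u \<in> carrier ?P" "X_pow n n \<ominus>\<^bsub>?P\<^esub> X_pow n 1 = u \<otimes>\<^bsub>?P\<^esub> f"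
    using is_gcmd_dvdE[OF gcmd1] f_carr by auto
  interpret E: ring_hom_cring ?P ?R "eval ?R ?R id (a mod int n)"
    by (rule eval_id_ring_hom_cring[OF carr])
  \<comment> \<open>Evaluating \<open>x^n - x = u * f\<close> at the root \<open>a\<close> of
    \<open>f\<close> gives \<open>a^n = a\<close> modulo \<open>n\<close>.\<close>
  have "(a mod int n) [^]\<^bsub>?R\<^esub> n \<ominus>\<^bsub>?R\<^esub> (a mod int n) = eval ?R ?R id (a mod int n) (u \<otimes>\<^bsub>?P\<^esub> f)"
    unfolding u(2)[symmetric] using carr by (simp only: eval_id_monom_diff res.nat_pow_eone)
  also have "\<dots> = \<zero>\<^bsub>?R\<^esub>"
  proof -
    have "eval ?R ?R id (a mod int n) f = \<zero>\<^bsub>?R\<^esub>"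
      using eval_f[of a] by (simp add: res.res_zero_eq)
    then show ?thesis using u f_carr by simp
  qed
  finally have "(a mod int n) [^]\<^bsub>?R\<^esub> n = a mod int n"
    using carr by simp
  then have "a ^ n mod int n = a mod int n"
    by (simp add: res.pow_cong)
  moreover have "a ^ n = a * a ^ (n - 1)"
    using n by (simp flip: power_Suc)
  ultimately have "[a * a ^ (n - 1) = a * 1] (mod int n)"
    by (simp add: cong_def)
  then have "[a ^ (n - 1) = 1] (mod int n)"
    using cong_mult_lcancel[OF cop_ab(1)] by blast
  with comp show ?thesis by (simp add: pseudoprime_def)
qed

theorem theorem4p5:
  fixes a b :: int and n :: nat
  assumes "frobenius_pseudoprime ([:- a, 1:] * [:- b, 1:]) n"
  shows "pseudoprime a n \<and> pseudoprime b n"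
  \<comment> \<open>The two linear factors commute, so the lemma also applies with \<open>a\<close>
    and \<open>b\<close> exchanged.\<close>
  using assms pseudoprime_if_frobenius_pseudoprime_quadratic[of a b n]
    pseudoprime_if_frobenius_pseudoprime_quadratic[of b a n]
  by (simp add: mult.commute)

end
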